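(* (Relative completeness of PRHL.) Suppose the language of assertions is WPR-expressive. Then every valid partial reverse Hoare triple $\{P\}\,C\,\{Q\}$ is provable in PRHL.
   Context: Programs, assertions and semantics: states $\sigma:\mathrm{Var}\to\mathbb{N}$; expressions $E ::= x\mid n\mid f(E,\dots,E)$; Boolean conditions $B ::= Q(E,\dots,E)\mid E=E\mid E\le E\mid\neg B\mid B\wedge B\mid B\vee B$; programs $C ::= \varepsilon\mid C'$, $C' ::= x:=E\mid C';C'\mid\mathtt{while}\ B\ \mathtt{do}\ C\mid C\ \mathtt{or}\ C$ ($\varepsilon$ the empty program; $C_0;C_1$ denotes $C_i$ when $C_{1-i}=\varepsilon$); assertions are first-order formulas over Boolean conditions with $\neg,\vee,\wedge,\to,\exists,\forall$, interpreted over $\mathbb{N}$ ($\sigma\models P$); $P\models Q$ means every state satisfying $P$ satisfies $Q$; $Q[x:=E]$ is substitution. Small-step semantics: $\langle x:=E,\sigma\rangle\to\langle\varepsilon,\sigma[x\mapsto[\![E]\!]\sigma]\rangle$; $\langle\mathtt{while}\ B\ \mathtt{do}\ C,\sigma\rangle\to\langle C;\mathtt{while}\ B\ \mathtt{do}\ C,\sigma\rangle$ if $B$ holds in $\sigma$, else $\to\langle\varepsilon,\sigma\rangle$; $\langle C_0;C_1,\sigma\rangle\to\langle C_0';C_1,\sigma'\rangle$ if $\langle C_0,\sigma\rangle\to\langle C_0',\sigma'\rangle$; $\langle C_0\ \mathtt{or}\ C_1,\sigma\rangle\to\langle C_i,\sigma\rangle$ ($i=0,1$); $\to^{*}$ the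 reflexive-transitive closure. A triple $\{P\}\,C\,\{Q\}$ is valid if for all $\sigma'\models Q$ and all $\sigma$ with $\langle C,\sigma\rangle\to^{*}\langle\varepsilon,\sigma'\rangle$, $\sigma\models P$. The language of assertions is WPR-expressive if for every assertion $Q$ and program $C$ there is an assertion $P$ such that for every state $\sigma$: $\sigma\models P$ iff there exists $\sigma'$ with $\langle C,\sigma\rangle\to^{*}\langle\varepsilon,\sigma'\rangle$ and $\sigma'\models Q$. PRHL is the proof system whose proofs are finite derivation trees built from the rules: (Axiom) $\{Q\}\,\varepsilon\,\{Q\}$; (Assign) $\{Q[x:=E]\}\,x:=E\,\{Q\}$; (Seq) from $\{P\}C_0\{R\}$ and $\{R\}C_1\{Q\}$ infer $\{P\}C_0;C_1\{Q\}$; (Cons) from $\{P\}C\{Q\}$ infer $\{P'\}C\{Q'\}$ provided $P\models P'$ and $Q'\models Q$; (Or) from $\{P\}C_0\{Q\}$ and $\{P\}C_1\{Q\}$ infer $\{P\}C_0\ \mathtt{or}\ C_1\{Q\}$; (While) from $\{B\to P\}C\{P\}$ infer $\{P\}\,\mathtt{while}\ B\ \mathtt{do}\ C\,\{\neg B\to P\}$. Every leaf must be an instance of Axiom or Assign. *)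

theory Defs
  imports Main "HOL-Library.Infinite_Typeclass"
begin

text \<open>
  The vocabulary is arbitrary: sets of function and predicate symbols with their arities, given as
  symbol/arity pairs, with an interpretation over the natural numbers. The values of \<open>fun_int\<close> and
  \<open>pred_int\<close> at symbols and argument lists outside \<open>funs\<close> and \<open>preds\<close> are irrelevant, since the
  \<open>wf\<close> predicates below confine attention to expressions over the vocabulary.
\<close>

record ('f, 'q) interp =
  funs :: "('f \<times> nat) set"
  preds :: "('q \<times> nat) set"
  fun_int :: "'f \<Rightarrow> nat list \<Rightarrow> nat"
  pred_int :: "'q \<Rightarrow> nat list \<Rightarrow> bool"

type_synonym 'v state = "'v \<Rightarrow> nat"

datatype ('v, 'f) expr =
    Var 'v
  | Num nat
  | App 'f "('v, 'f) expr list"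

datatype ('v, 'f, 'q) bexpr =
    Pred 'q "('v, 'f) expr list"
  | Equal "('v, 'f) expr" "('v, 'f) expr"
  | LessEq "('v, 'f) expr" "('v, 'f) expr"
  | BNot "('v, 'f, 'q) bexpr"
  | BAnd "('v, 'f, 'q) bexpr" "('v, 'f, 'q) bexpr"
  | BOr "('v, 'f, 'q) bexpr" "('v, 'f, 'q) bexpr"

text \<open>\<open>prog\<close> and \<open>neprog\<close> are the nonterminals \<open>C\<close> (possibly empty) and \<open>C'\<close> (nonempty).\<close>

datatype ('v, 'f, 'q) prog =
    Empty
  | Prog "('v, 'f, 'q) neprog"
and ('v, 'f, 'q) neprog =
    Assign 'v "('v, 'f) expr"
  | Seq "('v, 'f, 'q) neprog" "('v, 'f, 'q) neprog"
  | While "('v, 'f, 'q) bexpr" "('v, 'f, 'q) prog"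
  | Choice "('v, 'f, 'q) prog" "('v, 'f, 'q) prog"

text \<open>Composition of possibly empty programs; the empty program is a syntactic unit.\<close>

fun seq :: "('v, 'f, 'q) prog \<Rightarrow> ('v, 'f, 'q) prog \<Rightarrow> ('v, 'f, 'q) prog" (infixr ";;" 60) where
  "Empty ;; C = C"
| "C ;; Empty = C"
| "Prog C ;; Prog D = Prog (Seq C D)"

datatype ('v, 'f, 'q) assn =
    Cond "('v, 'f, 'q) bexpr"
  | Neg "('v, 'f, 'q) assn"
  | Disj "('v, 'f, 'q) assn" "('v, 'f, 'q) assn"
  | Conj "('v, 'f, 'q) assn" "('v, 'f, 'q) assn"
  | Imp "('v, 'f, 'q) assn" "('v, 'f, 'q) assn"
  | Exists 'v "('v, 'f, 'q) assn"
  | Forall 'v "('v, 'f, 'q) assn"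

fun wf_expr :: "('f, 'q) interp \<Rightarrow> ('v, 'f) expr \<Rightarrow> bool" where
  "wf_expr I (Var x) = True"
| "wf_expr I (Num n) = True"
| "wf_expr I (App f es) = ((f, length es) \<in> funs I \<and> (\<forall>e\<in>set es. wf_expr I e))"

fun wf_bexpr :: "('f, 'q) interp \<Rightarrow> ('v, 'f, 'q) bexpr \<Rightarrow> bool" where
  "wf_bexpr I (Pred q es) = ((q, length es) \<in> preds I \<and> (\<forall>e\<in>set es. wf_expr I e))"
| "wf_bexpr I (Equal e e') = (wf_expr I e \<and> wf_expr I e')"
| "wf_bexpr I (LessEq e e') = (wf_expr I e \<and> wf_expr I e')"
| "wf_bexpr I (BNot B) = wf_bexpr I B"
| "wf_bexpr I (BAnd B B') = (wf_bexpr I B \<and> wf_bexpr I B')"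
| "wf_bexpr I (BOr B B') = (wf_bexpr I B \<and> wf_bexpr I B')"

fun wf_prog :: "('f, 'q) interp \<Rightarrow> ('v, 'f, 'q) prog \<Rightarrow> bool"
  and wf_neprog :: "('f, 'q) interp \<Rightarrow> ('v, 'f, 'q) neprog \<Rightarrow> bool" where
  "wf_prog I Empty = True"
| "wf_prog I (Prog C) = wf_neprog I C"
| "wf_neprog I (Assign x e) = wf_expr I e"
| "wf_neprog I (Seq C D) = (wf_neprog I C \<and> wf_neprog I D)"
| "wf_neprog I (While B C) = (wf_bexpr I B \<and> wf_prog I C)"
| "wf_neprog I (Choice C D) = (wf_prog I C \<and> wf_prog I D)"

fun wf_assn :: "('f, 'q) interp \<Rightarrow> ('v, 'f, 'q) assn \<Rightarrow> bool" where
  "wf_assn I (Cond B) = wf_bexpr I B"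
| "wf_assn I (Neg P) = wf_assn I P"
| "wf_assn I (Disj P Q) = (wf_assn I P \<and> wf_assn I Q)"
| "wf_assn I (Conj P Q) = (wf_assn I P \<and> wf_assn I Q)"
| "wf_assn I (Imp P Q) = (wf_assn I P \<and> wf_assn I Q)"
| "wf_assn I (Exists x P) = wf_assn I P"
| "wf_assn I (Forall x P) = wf_assn I P"

fun eval :: "('f, 'q) interp \<Rightarrow> 'v state \<Rightarrow> ('v, 'f) expr \<Rightarrow> nat" where
  "eval I \<sigma> (Var x) = \<sigma> x"
| "eval I \<sigma> (Num n) = n"
| "eval I \<sigma> (App f es) = fun_int I f (map (eval I \<sigma>) es)"

fun beval :: "('f, 'q) interp \<Rightarrow> 'v state \<Rightarrow> ('v, 'f, 'q) bexpr \<Rightarrow> bool" where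
  "beval I \<sigma> (Pred q es) = pred_int I q (map (eval I \<sigma>) es)"
| "beval I \<sigma> (Equal e e') = (eval I \<sigma> e = eval I \<sigma> e')"
| "beval I \<sigma> (LessEq e e') = (eval I \<sigma> e \<le> eval I \<sigma> e')"
| "beval I \<sigma> (BNot B) = (\<not> beval I \<sigma> B)"
| "beval I \<sigma> (BAnd B B') = (beval I \<sigma> B \<and> beval I \<sigma> B')"
| "beval I \<sigma> (BOr B B') = (beval I \<sigma> B \<or> beval I \<sigma> B')"

fun sat :: "('f, 'q) interp \<Rightarrow> 'v state \<Rightarrow> ('v, 'f, 'q) assn \<Rightarrow> bool" where
  "sat I \<sigma> (Cond B) = beval I \<sigma> B"
| "sat I \<sigma> (Neg P) = (\<not> sat I \<sigma> P)"
| "sat I \<sigma> (Disj P Q) = (sat I \<sigma> P \<or> sat I \<sigma> Q)"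
| "sat I \<sigma> (Conj P Q) = (sat I \<sigma> P \<and> sat I \<sigma> Q)"
| "sat I \<sigma> (Imp P Q) = (sat I \<sigma> P \<longrightarrow> sat I \<sigma> Q)"
| "sat I \<sigma> (Exists x P) = (\<exists>n. sat I (\<sigma>(x := n)) P)"
| "sat I \<sigma> (Forall x P) = (\<forall>n. sat I (\<sigma>(x := n)) P)"

definition entails :: "('f, 'q) interp \<Rightarrow> ('v, 'f, 'q) assn \<Rightarrow> ('v, 'f, 'q) assn \<Rightarrow> bool" where
  "entails I P Q \<longleftrightarrow> (\<forall>\<sigma>. sat I \<sigma> P \<longrightarrow> sat I \<sigma> Q)"

fun vars :: "('v, 'f) expr \<Rightarrow> 'v set" where
  "vars (Var x) = {x}"
| "vars (Num n) = {}"
| "vars (App f es) = (\<Union>e\<in>set es. vars e)"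

fun bvars :: "('v, 'f, 'q) bexpr \<Rightarrow> 'v set" where
  "bvars (Pred q es) = (\<Union>e\<in>set es. vars e)"
| "bvars (Equal e e') = vars e \<union> vars e'"
| "bvars (LessEq e e') = vars e \<union> vars e'"
| "bvars (BNot B) = bvars B"
| "bvars (BAnd B B') = bvars B \<union> bvars B'"
| "bvars (BOr B B') = bvars B \<union> bvars B'"

fun free_vars :: "('v, 'f, 'q) assn \<Rightarrow> 'v set" where
  "free_vars (Cond B) = bvars B"
| "free_vars (Neg P) = free_vars P"
| "free_vars (Disj P Q) = free_vars P \<union> free_vars Q"
| "free_vars (Conj P Q) = free_vars P \<union> free_vars Q"
| "free_vars (Imp P Q) = free_vars P \<union> free_vars Q"
| "free_vars (Exists x P) = free_vars P - {x}"
| "free_vars (Forall x P) = free_vars P - {x}"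

fun subst_expr :: "('v \<Rightarrow> ('v, 'f) expr) \<Rightarrow> ('v, 'f) expr \<Rightarrow> ('v, 'f) expr" where
  "subst_expr s (Var x) = s x"
| "subst_expr s (Num n) = Num n"
| "subst_expr s (App f es) = App f (map (subst_expr s) es)"

fun subst_bexpr :: "('v \<Rightarrow> ('v, 'f) expr) \<Rightarrow> ('v, 'f, 'q) bexpr \<Rightarrow> ('v, 'f, 'q) bexpr" where
  "subst_bexpr s (Pred q es) = Pred q (map (subst_expr s) es)"
| "subst_bexpr s (Equal e e') = Equal (subst_expr s e) (subst_expr s e')"
| "subst_bexpr s (LessEq e e') = LessEq (subst_expr s e) (subst_expr s e')"
| "subst_bexpr s (BNot B) = BNot (subst_bexpr s B)"
| "subst_bexpr s (BAnd B B') = BAnd (subst_bexpr s B) (subst_bexpr s B')"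
| "subst_bexpr s (BOr B B') = BOr (subst_bexpr s B) (subst_bexpr s B')"

text \<open>
  The bound variable to use when a simultaneous substitution \<open>s\<close> is pushed under a quantifier
  binding \<open>y\<close> in front of \<open>P\<close>: \<open>y\<close> itself unless that would capture a variable, otherwise some
  variable that is not captured. It exists because there are infinitely many variables.
\<close>

definition bound_var ::
    "('v :: infinite \<Rightarrow> ('v, 'f) expr) \<Rightarrow> 'v \<Rightarrow> ('v, 'f, 'q) assn \<Rightarrow> 'v" where
  "bound_var s y P =
    (let A = (\<Union>w \<in> free_vars P - {y}. vars (s w)) in if y \<notin> A then y else (SOME z. z \<notin> A))"

text \<open>
  Substitution is simultaneous so that the renaming of a bound variable can be merged into it,
  which keeps the recursion structural.
\<close>

fun subst_assn ::
    "('v :: infinite \<Rightarrow> ('v, 'f) expr) \<Rightarrow> ('v, 'f, 'q) assn \<Rightarrow> ('v, 'f, 'q) assn" where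
  "subst_assn s (Cond B) = Cond (subst_bexpr s B)"
| "subst_assn s (Neg P) = Neg (subst_assn s P)"
| "subst_assn s (Disj P Q) = Disj (subst_assn s P) (subst_assn s Q)"
| "subst_assn s (Conj P Q) = Conj (subst_assn s P) (subst_assn s Q)"
| "subst_assn s (Imp P Q) = Imp (subst_assn s P) (subst_assn s Q)"
| "subst_assn s (Exists y P) = (let z = bound_var s y P in Exists z (subst_assn (s(y := Var z)) P))"
| "subst_assn s (Forall y P) = (let z = bound_var s y P in Forall z (subst_assn (s(y := Var z)) P))"

definition subst ::
    "('v :: infinite, 'f, 'q) assn \<Rightarrow> 'v \<Rightarrow> ('v, 'f) expr \<Rightarrow> ('v, 'f, 'q) assn"
    ("_[_ ::= _]" [1000, 0, 0] 999) where
  "Q[x ::= e] = subst_assn (Var(x := e)) Q"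

inductive step :: "('f, 'q) interp \<Rightarrow>
    ('v, 'f, 'q) prog \<times> 'v state \<Rightarrow> ('v, 'f, 'q) prog \<times> 'v state \<Rightarrow> bool" for I where
  StepAssign: "step I (Prog (Assign x e), \<sigma>) (Empty, \<sigma>(x := eval I \<sigma> e))"
| StepWhileTrue: "beval I \<sigma> B \<Longrightarrow>
    step I (Prog (While B C), \<sigma>) (C ;; Prog (While B C), \<sigma>)"
| StepWhileFalse: "\<not> beval I \<sigma> B \<Longrightarrow> step I (Prog (While B C), \<sigma>) (Empty, \<sigma>)"
| StepSeq: "step I (C0, \<sigma>) (C0', \<sigma>') \<Longrightarrow> step I (C0 ;; C1, \<sigma>) (C0' ;; C1, \<sigma>')"
| StepChoice0: "step I (Prog (Choice C0 C1), \<sigma>) (C0, \<sigma>)"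
| StepChoice1: "step I (Prog (Choice C0 C1), \<sigma>) (C1, \<sigma>)"

abbreviation steps :: "('f, 'q) interp \<Rightarrow>
    ('v, 'f, 'q) prog \<times> 'v state \<Rightarrow> ('v, 'f, 'q) prog \<times> 'v state \<Rightarrow> bool" where
  "steps I \<equiv> (step I)\<^sup>*\<^sup>*"

definition valid :: "('f, 'q) interp \<Rightarrow>
    ('v, 'f, 'q) assn \<Rightarrow> ('v, 'f, 'q) prog \<Rightarrow> ('v, 'f, 'q) assn \<Rightarrow> bool" where
  "valid I P C Q \<longleftrightarrow>
    (\<forall>\<sigma>'. sat I \<sigma>' Q \<longrightarrow> (\<forall>\<sigma>. steps I (C, \<sigma>) (Empty, \<sigma>') \<longrightarrow> sat I \<sigma> P))"

text \<open>
  The \<open>itself\<close> argument fixes the type of variables, which \<open>I\<close> alone does not determine.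
\<close>

definition WPR_expressive :: "'v itself \<Rightarrow> ('f, 'q) interp \<Rightarrow> bool" where
  "WPR_expressive (_ :: 'v itself) I \<longleftrightarrow>
    (\<forall>(Q :: ('v, 'f, 'q) assn) C. wf_assn I Q \<longrightarrow> wf_prog I C \<longrightarrow>
      (\<exists>P :: ('v, 'f, 'q) assn. wf_assn I P \<and>
        (\<forall>\<sigma>. sat I \<sigma> P \<longleftrightarrow> (\<exists>\<sigma>'. steps I (C, \<sigma>) (Empty, \<sigma>') \<and> sat I \<sigma>' Q))))"

text \<open>
  The side conditions \<open>wf\<close> ensure that all triples in a derivation are over the vocabulary of \<open>I\<close>.
\<close>

inductive PRHL :: "('f, 'q) interp \<Rightarrow> ('v :: infinite, 'f, 'q) assn \<Rightarrow>
    ('v, 'f, 'q) prog \<Rightarrow> ('v, 'f, 'q) assn \<Rightarrow> bool" for I where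
  Axiom: "wf_assn I Q \<Longrightarrow> PRHL I Q Empty Q"
| Assign: "wf_assn I Q \<Longrightarrow> wf_expr I e \<Longrightarrow> PRHL I (Q[x ::= e]) (Prog (Assign x e)) Q"
| Seq: "PRHL I P C0 R \<Longrightarrow> PRHL I R C1 Q \<Longrightarrow> PRHL I P (C0 ;; C1) Q"
| Cons: "PRHL I P C Q \<Longrightarrow> wf_assn I P' \<Longrightarrow> wf_assn I Q' \<Longrightarrow>
    entails I P P' \<Longrightarrow> entails I Q' Q \<Longrightarrow> PRHL I P' C Q'"
| Or: "PRHL I P C0 Q \<Longrightarrow> PRHL I P C1 Q \<Longrightarrow> PRHL I P (Prog (Choice C0 C1)) Q"
| While: "wf_bexpr I B \<Longrightarrow> PRHL I (Imp (Cond B) P) C P \<Longrightarrow>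
    PRHL I P (Prog (While B C)) (Imp (Cond (BNot B)) P)"

end

theory Submission imports Defs begin

text \<open>
  Induction on the program. Let \<open>W\<close> express the weakest pre-assertion of \<open>C\<close> and \<open>Q\<close>, i.e. the
  set of states from which \<open>C\<close> can terminate in a state satisfying \<open>Q\<close>. For a composition, the
  intermediate assertion is the weakest pre-assertion of the second component. For a loop, the
  weakest pre-assertion \<open>W\<close> of the whole loop is an invariant: if \<open>B\<close> holds in \<open>\<sigma>\<close> and the body
  leads from \<open>\<sigma>\<close> into \<open>W\<close>, then the loop leads from \<open>\<sigma>\<close> into \<open>Q\<close>, so \<open>{B \<rightarrow> W} C {W}\<close> is valid;
  moreover \<open>Q\<close> entails \<open>\<not> B \<rightarrow> W\<close>, because the loop may exit at once. Only the introduction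
  direction of the semantics is needed: executions are composed, never taken apart.
\<close>

lemma eval_cong: "(\<And>x. x \<in> vars e \<Longrightarrow> \<sigma> x = \<tau> x) \<Longrightarrow> eval I \<sigma> e = eval I \<tau> e"
proof (induction e)
  case (App f es)
  then have "map (eval I \<sigma>) es = map (eval I \<tau>) es"
    by (intro map_cong) auto
  then show ?case by (simp only: eval.simps)
qed auto

lemma beval_cong: "(\<And>x. x \<in> bvars B \<Longrightarrow> \<sigma> x = \<tau> x) \<Longrightarrow> beval I \<sigma> B = beval I \<tau> B"
proof (induction B)
  case (Pred q es)
  then have "map (eval I \<sigma>) es = map (eval I \<tau>) es"
    by (intro map_cong eval_cong) auto
  then show ?case by (simp only: beval.simps)
next
  case (Equal e e')
  then show ?case using eval_cong[of e \<sigma> \<tau> I] eval_cong[of e' \<sigma> \<tau> I] by simp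
next
  case (LessEq e e')
  then show ?case using eval_cong[of e \<sigma> \<tau> I] eval_cong[of e' \<sigma> \<tau> I] by simp
qed auto

lemma sat_cong: "(\<And>x. x \<in> free_vars P \<Longrightarrow> \<sigma> x = \<tau> x) \<Longrightarrow> sat I \<sigma> P = sat I \<tau> P"
proof (induction P arbitrary: \<sigma> \<tau>)
  case (Cond B)
  then show ?case using beval_cong[of B \<sigma> \<tau> I] by simp
next
  case (Neg P)
  then show ?case by (metis free_vars.simps(2) sat.simps(2))
next
  case (Disj P Q)
  then show ?case by (metis UnCI free_vars.simps(3) sat.simps(3))
next
  case (Conj P Q)
  then show ?case by (metis UnCI free_vars.simps(4) sat.simps(4))
next
  case (Imp P Q)
  then show ?case by (metis UnCI free_vars.simps(5) sat.simps(5))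
next
  case (Exists y P)
  have "sat I (\<sigma>(y := n)) P = sat I (\<tau>(y := n)) P" for n
    using Exists.prems by (intro Exists.IH) auto
  then show ?case by simp
next
  case (Forall y P)
  have "sat I (\<sigma>(y := n)) P = sat I (\<tau>(y := n)) P" for n
    using Forall.prems by (intro Forall.IH) auto
  then show ?case by simp
qed

lemma eval_subst_expr: "eval I \<sigma> (subst_expr s e) = eval I (\<lambda>v. eval I \<sigma> (s v)) e"
proof (induction e)
  case (App f es)
  then have "map (eval I \<sigma> \<circ> subst_expr s) es = map (eval I (\<lambda>v. eval I \<sigma> (s v))) es"
    by (intro map_cong) auto
  then show ?case by (simp only: eval.simps subst_expr.simps map_map)
qed auto

lemma beval_subst_bexpr: "beval I \<sigma> (subst_bexpr s B) = beval I (\<lambda>v. eval I \<sigma> (s v)) B"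
  by (induction B) (simp_all add: eval_subst_expr comp_def)

lemma finite_vars: "finite (vars e)"
  by (induction e) auto

lemma finite_bvars: "finite (bvars B)"
  by (induction B) (auto simp: finite_vars)

lemma finite_free_vars: "finite (free_vars P)"
  by (induction P) (auto simp: finite_bvars)

text \<open>The variables to avoid form a finite set, since \<open>P\<close> has finitely many free
  variables and each \<open>s w\<close> contains finitely many; as the type of variables is
  infinite, the \<open>SOME\<close> in \<open>bound_var\<close> picks a genuine witness.\<close>

lemma bound_var_fresh:
  assumes "w \<in> free_vars P" "w \<noteq> y"
  shows "bound_var s y P \<notin> vars (s w)"
proof -
  let ?A = "\<Union>w \<in> free_vars P - {y}. vars (s w)"
  have "\<exists>z. z \<notin> ?A"
    by (rule ex_new_if_finite) (auto simp: infinite_UNIV finite_free_vars finite_vars)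
  then have "(SOME z. z \<notin> ?A) \<notin> ?A"
    by (rule someI_ex)
  then have "bound_var s y P \<notin> ?A"
    unfolding bound_var_def Let_def by (cases "y \<in> ?A") simp_all
  with assms show ?thesis by blast
qed

text \<open>The quantifier case of the substitution lemma. For \<open>x\<close> free in
  \<open>P\<close> and distinct from \<open>y\<close>, the term \<open>s x\<close> does not contain
  \<open>z\<close>, so storing \<open>n\<close> in \<open>z\<close> is seen only through
  \<open>y\<close>.\<close>

lemma sat_bound_var:
  assumes "z = bound_var s y P"
  shows "sat I (\<lambda>v. eval I (\<sigma>(z := n)) ((s(y := Var z)) v)) P
    = sat I ((\<lambda>v. eval I \<sigma> (s v))(y := n)) P"
proof (rule sat_cong)
  fix x assume x: "x \<in> free_vars P"
  show "eval I (\<sigma>(z := n)) ((s(y := Var z)) x) = ((\<lambda>v. eval I \<sigma> (s v))(y := n)) x"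
  proof (cases "x = y")
    case False
    then have "z \<notin> vars (s x)"
      using x bound_var_fresh assms by metis
    then have "eval I (\<sigma>(z := n)) (s x) = eval I \<sigma> (s x)"
      by (intro eval_cong) auto
    with False show ?thesis by simp
  qed simp
qed

text \<open>Both \<open>s\<close> and \<open>\<sigma>\<close> must vary in the induction, because
  passing a quantifier extends \<open>s\<close> by a renaming and updates the state.\<close>

lemma sat_subst_assn: "sat I \<sigma> (subst_assn s P) = sat I (\<lambda>v. eval I \<sigma> (s v)) P"
proof (induction P arbitrary: \<sigma> s)
  case (Exists y P)
  show ?case
    unfolding subst_assn.simps sat.simps Let_def Exists.IH sat_bound_var[OF refl] by (rule refl)
next
  case (Forall y P)
  show ?case
    unfolding subst_assn.simps sat.simps Let_def Forall.IH sat_bound_var[OF refl] by (rule refl)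
qed (simp_all add: beval_subst_bexpr)

lemma sat_subst: "sat I \<sigma> (Q[x ::= e]) = sat I (\<sigma>(x := eval I \<sigma> e)) Q"
proof -
  have "(\<lambda>v. eval I \<sigma> ((Var(x := e)) v)) = \<sigma>(x := eval I \<sigma> e)"
    by auto
  then show ?thesis by (simp only: subst_def sat_subst_assn)
qed

lemma steps_seq_left:
  assumes "steps I (C, \<sigma>) (C', \<sigma>')"
  shows "steps I (C ;; D, \<sigma>) (C' ;; D, \<sigma>')"
  using assms
  by (induction rule: rtranclp_induct2) (auto intro: StepSeq rtranclp.rtrancl_into_rtrancl)

text \<open>The lifted first run ends in \<open>Empty ;; D\<close>, which is \<open>D\<close> by the
  unit law of \<open>;;\<close>, so the second run can be appended directly.\<close>

lemma steps_seq:
  assumes "steps I (C, \<sigma>) (Empty, \<sigma>')" "steps I (D, \<sigma>') (Empty, \<sigma>'')"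
  shows "steps I (C ;; D, \<sigma>) (Empty, \<sigma>'')"
  using steps_seq_left[OF assms(1), of D] assms(2) by simp

lemma steps_while:
  assumes "beval I \<sigma> B" "steps I (C, \<sigma>) (Empty, \<sigma>')"
    "steps I (Prog (While B C), \<sigma>') (Empty, \<sigma>'')"
  shows "steps I (Prog (While B C), \<sigma>) (Empty, \<sigma>'')"
  using StepWhileTrue[OF assms(1)] steps_seq[OF assms(2,3)]
  by (rule converse_rtranclp_into_rtranclp)

lemma steps_choice:
  assumes "steps I (C, \<sigma>) (Empty, \<sigma>') \<or> steps I (D, \<sigma>) (Empty, \<sigma>')"
  shows "steps I (Prog (Choice C D), \<sigma>) (Empty, \<sigma>')"
  using assms by (auto intro: converse_rtranclp_into_rtranclp StepChoice0 StepChoice1)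

lemma WPR_expressiveE:
  fixes Q :: "('v, 'f, 'q) assn"
  assumes "WPR_expressive TYPE('v) I" "wf_assn I Q" "wf_prog I C"
  obtains W :: "('v, 'f, 'q) assn" where "wf_assn I W"
    "\<And>\<sigma>. sat I \<sigma> W \<longleftrightarrow> (\<exists>\<sigma>'. steps I (C, \<sigma>) (Empty, \<sigma>') \<and> sat I \<sigma>' Q)"
  using assms unfolding WPR_expressive_def by blast

lemma PRHL_complete:
  fixes C :: "('v :: infinite, 'f, 'q) prog" and D :: "('v, 'f, 'q) neprog"
  assumes expr: "WPR_expressive TYPE('v) I"
  shows "wf_prog I C \<Longrightarrow> wf_assn I P \<Longrightarrow> wf_assn I Q \<Longrightarrow> valid I P C Q \<Longrightarrow> PRHL I P C Q"
    and "wf_neprog I D \<Longrightarrow> wf_assn I P \<Longrightarrow> wf_assn I Q \<Longrightarrow> valid I P (Prog D) Q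
      \<Longrightarrow> PRHL I P (Prog D) Q"
proof (induction C and D arbitrary: P Q and P Q)
  case Empty
  \<comment> \<open>The run of length zero turns validity into an entailment.\<close>
  then have "entails I Q P"
    by (auto simp: valid_def entails_def)
  with Empty show ?case
    by (blast intro: Cons Axiom[of I P] entails_def[THEN iffD2])
next
  case (Prog D)
  then show ?case by simp
next
  case (Assign x e)
  \<comment> \<open>By the substitution lemma, \<open>Q[x ::= e]\<close> holds exactly where the
    one-step run of the assignment ends in \<open>Q\<close>.\<close>
  have "entails I (Q[x ::= e]) P"
    using Assign.prems(4) unfolding valid_def entails_def sat_subst
    by (blast intro: StepAssign)
  with Assign.prems show ?case
    by (intro Cons[OF PRHL.Assign[of I Q e x]]) (simp_all add: entails_def)
next
  case (Seq C D)
  from expr Seq.prems obtain R :: "('v, 'f, 'q) assn" where R: "wf_assn I R"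
    "\<And>\<sigma>. sat I \<sigma> R \<longleftrightarrow> (\<exists>\<sigma>'. steps I (Prog D, \<sigma>) (Empty, \<sigma>') \<and> sat I \<sigma>' Q)"
    by (auto elim!: WPR_expressiveE[of I Q "Prog D"])
  \<comment> \<open>A run of \<open>C\<close> into \<open>R\<close> continues by a run of
    \<open>D\<close> into \<open>Q\<close>; validity of the composed triple then gives
    \<open>P\<close> at the start.\<close>
  have "valid I P (Prog C) R"
    using Seq.prems(4) steps_seq[of I "Prog C" _ _ "Prog D"] unfolding valid_def R(2)
    by fastforce
  moreover have "valid I R (Prog D) Q"
    unfolding valid_def R(2) by blast
  ultimately have "PRHL I P (Prog C ;; Prog D) Q"
    using Seq R(1) by (intro PRHL.Seq[of I P "Prog C" R]) auto
  then show ?case by simp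
next
  case (While B C)
  from expr While.prems obtain W :: "('v, 'f, 'q) assn" where W: "wf_assn I W"
    "\<And>\<sigma>. sat I \<sigma> W \<longleftrightarrow> (\<exists>\<sigma>'. steps I (Prog (While B C), \<sigma>) (Empty, \<sigma>') \<and> sat I \<sigma>' Q)"
    by (auto elim!: WPR_expressiveE[of I Q "Prog (While B C)"])
  have "valid I (Imp (Cond B) W) C W"
    unfolding valid_def sat.simps W(2) by (blast intro: steps_while)
  then have "PRHL I (Imp (Cond B) W) C W"
    using While W(1) by simp
  then have "PRHL I W (Prog (While B C)) (Imp (Cond (BNot B)) W)"
    using While.prems by (intro PRHL.While) auto
  \<comment> \<open>Validity of the given triple says exactly that its weakest pre-assertion
    \<open>W\<close> entails \<open>P\<close>.\<close>
  moreover have "entails I W P"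
    using While.prems(4) unfolding valid_def entails_def W(2) by blast
  moreover have "entails I Q (Imp (Cond (BNot B)) W)"
    unfolding entails_def sat.simps beval.simps W(2) by (blast intro: StepWhileFalse)
  ultimately show ?case
    using While.prems by (blast intro: Cons)
next
  case (Choice C D)
  \<comment> \<open>Prefixing a run of either branch with the choice step gives a run of the whole
    choice.\<close>
  then have "valid I P C Q" "valid I P D Q"
    unfolding valid_def by (blast intro: steps_choice)+
  with Choice show ?case
    by (intro Or) auto
qed

theorem theorem3p6:
  fixes I :: "('f, 'q) interp"
    and P Q :: "('v :: infinite, 'f, 'q) assn"
    and C :: "('v, 'f, 'q) prog"
  assumes "WPR_expressive TYPE('v) I"
    and "wf_assn I P" and "wf_prog I C" and "wf_assn I Q"
    and "valid I P C Q"
  shows "PRHL I P C Q"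
  using PRHL_complete(1)[OF assms(1,3,2,4,5)] .

end
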